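(* Let $A_1,\dots,A_M\in\mathbb{R}^{n\times n}$, $\mathcal{M}=\{1,\dots,M\}$ and $A(w)=\sum_{i\in\mathcal{M}}w_iA_i$ for $w\in\mathcal{W}$. Let $V$ be a weak polyhedral Lyapunov function for the differential inclusion $\dot x(t)=A(w(t))x(t)$. Then $A(w)$ is robustly non-singular, i.e. $\mathcal{K}=\{0\}$ where $\mathcal{K}$ is the weak kernel of the differential inclusion, if and only if the solution $x(t)$ of the differential inclusion tends to $0$ for all $x(0)\in\mathbb{R}^n$ and all $(w(t))_{t\ge0}$.
   Context: $\mathcal{W}=\{w\in\mathbb{R}^M:\ \sum_{i\in\mathcal{M}}w_i=1,\ w_i\ge0\ \forall i\in\mathcal{M}\}$; signals are measurable functions $w(t)\in\mathcal{W}$, $t\ge0$. The weak kernel is $\mathcal{K}=\{x\in\mathbb{R}^n\mid\exists\,w\in\mathcal{W}\text{ such that }A(w)x=0\}$. A weak polyhedral Lyapunov function is a positive definite function $V:\mathbb{R}^n\to\mathbb{R}_{\ge0}$ of the form $V(x)=\max_{i=1,\dots,s}f_i^\top x$, for some vectors $f_1,\dots,f_s\in\mathbb{R}^n$, such that $\limsup_{h\to0^+}\frac{V(x+hA(w)x)-V(x)}{h}\le0$ for all $x\in\mathbb{R}^n$, $w\in\mathcal{W}$. *)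

theory Defs
  imports "HOL-Analysis.Analysis"
begin

definition weight_simplex :: "(real ^ 'm::finite) set" where
  "weight_simplex = {w. (\<Sum>i\<in>UNIV. w $ i) = 1 \<and> (\<forall>i. 0 \<le> w $ i)}"

definition weighted_matrix ::
    "('m::finite \<Rightarrow> real ^ 'n ^ 'n) \<Rightarrow> real ^ 'm \<Rightarrow> real ^ 'n ^ 'n" where
  "weighted_matrix A w = (\<Sum>i\<in>UNIV. (w $ i) *\<^sub>R A i)"

definition weak_kernel :: "('m::finite \<Rightarrow> real ^ 'n ^ 'n) \<Rightarrow> (real ^ 'n) set" where
  "weak_kernel A = {x. \<exists>w\<in>weight_simplex. weighted_matrix A w *v x = 0}"

text \<open>Lebesgue measurability on the half-line; values at negative times are irrelevant.\<close>

definition admissible_signal :: "(real \<Rightarrow> real ^ 'm::finite) \<Rightarrow> bool" where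
  "admissible_signal w \<longleftrightarrow>
     w \<in> borel_measurable (lebesgue_on {0..}) \<and> (\<forall>t\<ge>0. w t \<in> weight_simplex)"

text \<open>The usual \<open>\<epsilon>\<close>-\<open>\<delta>\<close> notion of absolute continuity of a function on \<open>{a..b}\<close>: a set \<open>D\<close> with
  \<open>D division_of \<Union>D\<close> is an arbitrary finite family of nonempty compact intervals with disjoint
  interiors, and the endpoints of \<open>K \<in> D\<close> are \<open>Inf K\<close> and \<open>Sup K\<close>.\<close>

definition abs_continuous_on_interval ::
    "real \<Rightarrow> real \<Rightarrow> (real \<Rightarrow> 'a::real_normed_vector) \<Rightarrow> bool" where
  "abs_continuous_on_interval a b f \<longleftrightarrow>
     (\<forall>\<epsilon>>0. \<exists>\<delta>>0. \<forall>D. D division_of \<Union>D \<and> \<Union>D \<subseteq> {a..b} \<and> (\<Sum>K\<in>D. Sup K - Inf K) < \<delta>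
        \<longrightarrow> (\<Sum>K\<in>D. norm (f (Sup K) - f (Inf K))) < \<epsilon>)"

text \<open>Since the signal is merely measurable, solutions are meant in the sense of Caratheodory.\<close>

definition inclusion_solution ::
    "('m::finite \<Rightarrow> real ^ 'n ^ 'n) \<Rightarrow> (real \<Rightarrow> real ^ 'm) \<Rightarrow> real ^ 'n \<Rightarrow> (real \<Rightarrow> real ^ 'n) \<Rightarrow> bool"
  where
  "inclusion_solution A w x0 x \<longleftrightarrow>
     x 0 = x0 \<and>
     (\<forall>T\<ge>0. abs_continuous_on_interval 0 T x) \<and>
     (AE t in lebesgue_on {0..}.
        (x has_vector_derivative (weighted_matrix A (w t) *v x t)) (at t within {0..}))"

definition weak_polyhedral_lyapunov ::
    "('m::finite \<Rightarrow> real ^ 'n ^ 'n) \<Rightarrow> (real ^ 'n \<Rightarrow> real) \<Rightarrow> bool" where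
  "weak_polyhedral_lyapunov A V \<longleftrightarrow>
     V 0 = 0 \<and> (\<forall>x. x \<noteq> 0 \<longrightarrow> 0 < V x) \<and>
     (\<exists>(s::nat) (f :: nat \<Rightarrow> real ^ 'n).
        1 \<le> s \<and> (\<forall>x. V x = Max ((\<lambda>i. f i \<bullet> x) ` {1..s}))) \<and>
     (\<forall>x. \<forall>w\<in>weight_simplex.
        Limsup (at_right 0)
          (\<lambda>h. ereal ((V (x + h *\<^sub>R (weighted_matrix A w *v x)) - V x) / h)) \<le> 0)"

end

theory Submission
  imports Defs
begin

text \<open>The easy direction: a nonzero \<open>x0\<close> with \<open>A(w) x0 = 0\<close> is a constant solution for the
  constant signal \<open>w\<close>, and it does not tend to \<open>0\<close>.

  For the converse write \<open>V x = Max\<^sub>i (f i \<bullet> x)\<close> and call \<open>i\<close> active at \<open>x\<close> if \<open>f i \<bullet> x = V x\<close>.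
  The Lyapunov condition says that \<open>f i \<bullet> A(w) x \<le> 0\<close> whenever \<open>i\<close> is active at \<open>x\<close>. The proof
  combines a static fact with a limiting argument.

  The static fact (\<open>active_sum_decreases\<close>): if \<open>A(w)\<close> is non-singular and \<open>z \<noteq> 0\<close>, then some active
  functional strictly decreases at \<open>z\<close>, so the sum \<open>p\<close> of the functionals active at \<open>z\<close> satisfies
  \<open>p \<bullet> A(w) z < 0\<close>. Otherwise \<open>A(w)\<close> would be tangent at \<open>z\<close>, hence everywhere, to the face \<open>F\<close> of
  the polytope \<open>{y. V y \<le> V z}\<close> that contains \<open>z\<close> in its relative interior, and would point into
  \<open>F\<close> at each of its points. If \<open>0\<close> is not in the compact convex image \<open>A(w) F\<close>, separation gives a
  functional that is positive on this image; at a maximiser over \<open>F\<close> of that functional, a small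
  step along \<open>A(w)\<close> stays in \<open>F\<close> and increases the functional, which is absurd. So \<open>A(w)\<close> vanishes
  at a nonzero point of \<open>F\<close>. Compactness of the simplex makes the strict decrease uniform in \<open>w\<close> and
  in a neighbourhood of \<open>z\<close> (\<open>uniform_active_decrease\<close>).

  The limiting argument (\<open>solution_tendsto_0\<close>): \<open>V\<close> does not increase along a solution \<open>x\<close>, so \<open>x\<close>
  is bounded and \<open>V\<close> is constant on the set \<open>\<Omega>\<close> of its limit points. If \<open>x\<close> does not tend to \<open>0\<close>,
  then \<open>0 \<notin> \<Omega>\<close>; take \<open>z \<in> \<Omega>\<close> with the fewest active functionals. Active sets can only shrink
  nearby, so by minimality all limit points near \<open>z\<close> have the same active set, and \<open>p\<close> has the same
  value at all of them. But each time the solution comes close to \<open>z\<close> it stays near \<open>z\<close> for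
  a fixed time \<open>h\<close>, and \<open>p\<close> drops by a fixed amount meanwhile. Passing to the limit
  contradicts the constancy of \<open>p\<close>.

  Signals are only measurable, so all growth estimates along solutions go through one
  comparison principle for absolutely continuous functions, \<open>increment_le_of_local_bounds\<close>.\<close>

section \<open>A comparison principle for absolutely continuous functions\<close>

lemma division_length_le_measure:
  fixes D :: "real set set"
  assumes "D division_of \<Union>D" "\<Union>D \<subseteq> U" "U \<in> lmeasurable"
  shows "(\<Sum>K\<in>D. Sup K - Inf K) \<le> measure lebesgue U"
proof -
  have len: "Sup K - Inf K = measure lborel K" if "K \<in> D" for K
  proof -
    obtain a b where "K = cbox a b" "K \<noteq> {}"
      using division_ofD(3,4)[OF assms(1) \<open>K \<in> D\<close>] by metis
    then show ?thesis by auto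
  qed
  have "((\<lambda>x. 1::real) has_integral (\<Sum>K\<in>D. measure lborel K)) (\<Union>D)"
  proof (rule has_integral_combine_division[OF assms(1)])
    fix K assume "K \<in> D"
    then obtain a b where "K = cbox a b"
      using division_ofD(4)[OF assms(1)] by metis
    then show "((\<lambda>x. 1::real) has_integral measure lborel K) K"
      using has_integral_const[of "1::real" a b] by simp
  qed
  moreover have "\<Union>D \<in> lmeasurable"
    using division_ofD(1,4)[OF assms(1)]
    by (intro lmeasurable_compact compact_Union) (auto intro: compact_cbox simp del: box_real)
  ultimately have "(\<Sum>K\<in>D. measure lborel K) = measure lebesgue (\<Union>D)"
    by (metis lmeasure_integral integral_unique)
  also have "\<dots> \<le> measure lebesgue U"
    using assms \<open>\<Union>D \<in> lmeasurable\<close> by (intro measure_mono_fmeasurable) auto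
  finally show ?thesis using len by simp
qed

lemma negligible_open_cover:
  fixes N :: "real set"
  assumes "negligible N" "0 < \<delta>"
  obtains U where "open U" "N \<subseteq> U" "U \<in> lmeasurable" "measure lebesgue U < \<delta>"
proof -
  have N: "N \<in> null_sets lebesgue" using assms negligible_iff_null_sets by blast
  then obtain U where U: "open U" "N \<subseteq> U" "U - N \<in> lmeasurable"
      "emeasure lebesgue (U - N) < ennreal \<delta>"
    using sets_lebesgue_outer_open[of N \<delta>] assms(2) by blast
  have "U \<in> lmeasurable"
    using U(1,3) N by (metis borel_open measurable_Diff_null_set sets_completionI_sets sets_lborel)
  moreover have "measure lebesgue (U - N) = measure lebesgue U"
    using U(1) N by (intro measure_Diff_null_set) auto
  moreover have "measure lebesgue (U - N) < \<delta>"
    using U(3,4) assms(2) by (simp add: emeasure_eq_measure2 ennreal_less_iff)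
  ultimately show thesis using that U by auto
qed

text \<open>Absolute continuity speaks of intervals, the gauge integral of tagged intervals. The same
  interval can carry two tags only if it is a point, and then it contributes nothing.\<close>

lemma tagged_sum_eq_division_sum:
  fixes d :: "real set \<Rightarrow> real"
  assumes p: "p tagged_partial_division_of S" and d: "\<And>u. d {u} = 0"
  shows "(\<Sum>(t,K)\<in>p. d K) = (\<Sum>K\<in>snd ` p. d K)"
proof -
  define e where "e K = (if K = {} then 0 else d K)" for K
  have ne: "K \<noteq> {}" if "(t, K) \<in> p" for t K
    using tagged_partial_division_ofD(2)[OF p that] by auto
  have "(\<Sum>(t,K)\<in>p. e K) = (\<Sum>K\<in>snd ` p. e K)"
  proof (rule sum.over_tagged_division_lemma[OF tagged_partial_division_of_Union_self[OF p]])
    fix u v :: real assume "box u v = {}"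
    then show "e (cbox u v) = 0"
      using d by (cases "u = v") (auto simp: e_def box_eq_empty)
  qed
  moreover have "(\<Sum>(t,K)\<in>p. e K) = (\<Sum>(t,K)\<in>p. d K)"
    using ne by (intro sum.cong) (auto simp: e_def)
  moreover have "(\<Sum>K\<in>snd ` p. e K) = (\<Sum>K\<in>snd ` p. d K)"
    using ne by (intro sum.cong) (auto simp: e_def)
  ultimately show ?thesis by simp
qed

text \<open>An a.e. bound on the growth rate of \<open>g\<close> bounds its increment as soon as the increments of \<open>g\<close> are
  dominated by those of an absolutely continuous \<open>x\<close>. Choose a tagged division that is fine
  for the local bounds off the exceptional set \<open>N\<close>, and for a small open cover \<open>U\<close> of \<open>N\<close> on
  \<open>N\<close>: the intervals tagged in \<open>N\<close> have small total length, hence by absolute continuity a small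
  total increment. The local bound concerns increments over intervals around \<open>t\<close> instead of
  a derivative of \<open>g\<close>, so that the lemma also applies to \<open>V \<circ> x\<close>, where \<open>V\<close> need not be differentiable.\<close>

lemma increment_le_of_local_bounds:
  fixes g :: "real \<Rightarrow> real" and x :: "real \<Rightarrow> 'a::real_normed_vector"
  assumes ab: "a \<le> b" and N: "negligible N"
    and ac: "abs_continuous_on_interval a b x"
    and lip: "\<And>u v. g v - g u \<le> L * norm (x v - x u)"
    and loc: "\<And>t e. \<lbrakk>t \<in> {a..b} - N; e > 0\<rbrakk> \<Longrightarrow>
       \<exists>d>0. \<forall>u\<in>{a..b}. \<forall>v\<in>{a..b}. t - d < u \<longrightarrow> u \<le> t \<longrightarrow> t \<le> v \<longrightarrow> v < t + d \<longrightarrow>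
          g v - g u \<le> (c + e) * (v - u)"
  shows "g b - g a \<le> c * (b - a)"
proof -
  have main: "g b - g a \<le> c * (b - a) + e * ((b - a) + \<bar>L\<bar> + 1)" if e: "e > 0" for e
  proof -
    obtain \<delta> where \<delta>: "\<delta> > 0" and ac\<delta>: "\<And>D. \<lbrakk>D division_of \<Union>D; \<Union>D \<subseteq> {a..b};
        (\<Sum>K\<in>D. Sup K - Inf K) < \<delta>\<rbrakk> \<Longrightarrow> (\<Sum>K\<in>D. norm (x (Sup K) - x (Inf K))) < e"
      using ac e unfolding abs_continuous_on_interval_def by meson
    \<comment> \<open>Total length below \<open>e / (\<bar>c + e\<bar> + 1)\<close> makes the linear term lost on \<open>N\<close> at most \<open>e\<close>.\<close>
    define \<mu> where "\<mu> = min \<delta> (e / (\<bar>c + e\<bar> + 1))"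
    have \<mu>: "\<mu> > 0" using \<delta> e by (simp add: \<mu>_def)
    obtain U where U: "open U" "N \<subseteq> U" "U \<in> lmeasurable" "measure lebesgue U < \<mu>"
      using negligible_open_cover[OF N \<mu>] by blast
    have "\<exists>d. \<forall>t\<in>{a..b} - N. d t > 0 \<and> (\<forall>u\<in>{a..b}. \<forall>v\<in>{a..b}. t - d t < u \<longrightarrow> u \<le> t \<longrightarrow>
          t \<le> v \<longrightarrow> v < t + d t \<longrightarrow> g v - g u \<le> (c + e) * (v - u))"
      using loc e by (intro bchoice) blast
    then obtain d where dd: "\<forall>t\<in>{a..b} - N. d t > 0 \<and> (\<forall>u\<in>{a..b}. \<forall>v\<in>{a..b}. t - d t < u \<longrightarrow> u \<le> t \<longrightarrow>
          t \<le> v \<longrightarrow> v < t + d t \<longrightarrow> g v - g u \<le> (c + e) * (v - u))" by blast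
    then have d0: "\<And>t. t \<in> {a..b} - N \<Longrightarrow> d t > 0" and
      d: "\<And>t u v. \<lbrakk>t \<in> {a..b} - N; u \<in> {a..b}; v \<in> {a..b}; t - d t < u; u \<le> t; t \<le> v; v < t + d t\<rbrakk>
           \<Longrightarrow> g v - g u \<le> (c + e) * (v - u)"
      by blast+
    define \<gamma> where "\<gamma> t = (if t \<in> N then U else if t \<in> {a..b} then ball t (d t) else UNIV)" for t
    have "gauge \<gamma>"
      using U(1,2) d0 by (auto simp: gauge_def \<gamma>_def)
    then obtain p where p: "p tagged_division_of {a..b}" and fine: "\<gamma> fine p"
      by (rule fine_division_exists_real)
    have fin: "finite p" using p by blast
    have K: "\<exists>u v. K = {u..v} \<and> Inf K = u \<and> Sup K = v \<and> u \<le> t \<and> t \<le> v \<and> a \<le> u \<and> v \<le> b"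
      if "(t, K) \<in> p" for t K
    proof -
      obtain u v where "K = cbox u v" using tagged_division_ofD(4)[OF p \<open>(t,K) \<in> p\<close>] by blast
      moreover have "t \<in> K" "K \<subseteq> {a..b}" using tagged_division_ofD(2,3)[OF p \<open>(t,K) \<in> p\<close>] by auto
      ultimately show ?thesis by (intro exI[of _ u] exI[of _ v]) auto
    qed
    define q where "q = {z \<in> p. fst z \<in> N}"
    have q: "q \<subseteq> p" by (auto simp: q_def)
    have qp: "q tagged_partial_division_of {a..b}"
      using p q by (meson tagged_division_of_def tagged_partial_division_subset)
    let ?D = "snd ` q"
    have D: "?D division_of \<Union>?D" by (rule partial_division_of_tagged_division[OF qp])
    have "K \<subseteq> U" if "(t, K) \<in> q" for t K
      using fineD[OF fine, of t K] that by (auto simp: q_def \<gamma>_def)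
    then have DU: "\<Union>?D \<subseteq> U" by fastforce
    have len: "(\<Sum>K\<in>?D. Sup K - Inf K) < \<mu>"
      using division_length_le_measure[OF D DU U(3)] U(4) by simp
    have lenq: "(\<Sum>(t,K)\<in>q. Sup K - Inf K) = (\<Sum>K\<in>?D. Sup K - Inf K)"
      by (rule tagged_sum_eq_division_sum[OF qp]) auto
    have len0: "0 \<le> (\<Sum>(t,K)\<in>q. Sup K - Inf K)"
      using K q by (intro sum_nonneg) fastforce
    have "\<Union>?D \<subseteq> {a..b}" using tagged_partial_division_ofD(3)[OF qp] by fastforce
    then have "(\<Sum>K\<in>?D. norm (x (Sup K) - x (Inf K))) < e"
      using len by (intro ac\<delta> D) (auto simp: \<mu>_def)
    moreover have "(\<Sum>(t,K)\<in>q. norm (x (Sup K) - x (Inf K))) = (\<Sum>K\<in>?D. norm (x (Sup K) - x (Inf K)))"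
      by (rule tagged_sum_eq_division_sum[OF qp]) auto
    ultimately have var: "(\<Sum>(t,K)\<in>q. norm (x (Sup K) - x (Inf K))) < e" by simp
    \<comment> \<open>The excess of the increment over the claimed rate: nonpositive off \<open>N\<close>, small in total on \<open>N\<close>.\<close>
    define h where "h = (\<lambda>(t::real, K). g (Sup K) - g (Inf K) - (c + e) * (Sup K - Inf K))"
    have "g b - g a - (c + e) * (b - a) = (\<Sum>(t,K)\<in>p. g (Sup K) - g (Inf K)) - (c + e) * (\<Sum>(t,K)\<in>p. Sup K - Inf K)"
      using additive_tagged_division_1[OF ab p, of g] additive_tagged_division_1[OF ab p, of "\<lambda>x. x"]
      by simp
    also have "(c + e) * (\<Sum>(t,K)\<in>p. Sup K - Inf K) = (\<Sum>(t,K)\<in>p. (c + e) * (Sup K - Inf K))"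
      by (simp only: sum_distrib_left case_prod_unfold)
    also have "(\<Sum>(t,K)\<in>p. g (Sup K) - g (Inf K)) - (\<Sum>(t,K)\<in>p. (c + e) * (Sup K - Inf K)) = sum h p"
      by (simp only: h_def sum_subtractf[symmetric] case_prod_unfold)
    also have "\<dots> = sum h (p - q) + sum h q"
      by (rule sum.subset_diff[OF q fin])
    also have "sum h (p - q) \<le> 0"
    proof (rule sum_nonpos)
      fix z assume "z \<in> p - q"
      then obtain t K' where z: "z = (t, K')" "(t, K') \<in> p" "t \<notin> N" by (cases z) (auto simp: q_def)
      obtain u v where uv: "K' = {u..v}" "Inf K' = u" "Sup K' = v" "u \<le> t" "t \<le> v" "a \<le> u" "v \<le> b"
        using K[OF z(2)] by auto
      have "K' \<subseteq> ball t (d t)"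
        using fineD[OF fine z(2)] z(3) uv by (auto simp: \<gamma>_def)
      moreover have "u \<in> K'" "v \<in> K'" using uv by simp_all
      ultimately have "u \<in> ball t (d t)" "v \<in> ball t (d t)" by blast+
      then show "h z \<le> 0"
        using d[of t u v] z uv by (auto simp: h_def dist_real_def)
    qed
    also have "sum h q \<le> \<bar>L\<bar> * e + e"
    proof -
      have "sum h q \<le> (\<Sum>z\<in>q. \<bar>L\<bar> * (case z of (t,K) \<Rightarrow> norm (x (Sup K) - x (Inf K)))
               + \<bar>c + e\<bar> * (case z of (t,K) \<Rightarrow> Sup K - Inf K))"
      proof (rule sum_mono)
        fix z assume "z \<in> q"
        then obtain t K' where z: "z = (t, K')" "(t, K') \<in> p" using q by (cases z) auto
        have "g (Sup K') - g (Inf K') \<le> \<bar>L\<bar> * norm (x (Sup K') - x (Inf K'))"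
          by (rule order_trans[OF lip]) (simp add: mult_right_mono)
        moreover have "- (c + e) * (Sup K' - Inf K') \<le> \<bar>c + e\<bar> * (Sup K' - Inf K')"
          using K[OF z(2)] by (intro mult_right_mono) auto
        ultimately show "h z \<le> \<bar>L\<bar> * (case z of (t,K) \<Rightarrow> norm (x (Sup K) - x (Inf K)))
               + \<bar>c + e\<bar> * (case z of (t,K) \<Rightarrow> Sup K - Inf K)"
          by (simp add: h_def z algebra_simps)
      qed
      also have "\<dots> = \<bar>L\<bar> * (\<Sum>(t,K)\<in>q. norm (x (Sup K) - x (Inf K)))
               + \<bar>c + e\<bar> * (\<Sum>(t,K)\<in>q. Sup K - Inf K)"
        by (simp add: sum.distrib sum_distrib_left)
      also have "\<dots> \<le> \<bar>L\<bar> * e + \<bar>c + e\<bar> * (e / (\<bar>c + e\<bar> + 1))"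
        using var len lenq by (intro add_mono mult_left_mono) (auto simp: \<mu>_def)
      also have "\<bar>c + e\<bar> * (e / (\<bar>c + e\<bar> + 1)) \<le> e"
        using e by (simp add: field_simps)
      finally show ?thesis by simp
    qed
    finally show ?thesis by (simp add: algebra_simps)
  qed
  show ?thesis
  proof (rule field_le_epsilon)
    fix e :: real assume e: "e > 0"
    have "(b - a) + \<bar>L\<bar> + 1 > 0" using ab by linarith
    then show "g b - g a \<le> c * (b - a) + e"
      using main[of "e / ((b - a) + \<bar>L\<bar> + 1)"] e by simp
  qed
qed

section \<open>Positive definite maxima of linear functionals\<close>

locale polyhedral_gauge =
  fixes J :: "nat set" and f :: "nat \<Rightarrow> 'a::euclidean_space"
  assumes finite_J: "finite J" and J_nonempty: "J \<noteq> {}"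
    and positive: "x \<noteq> 0 \<Longrightarrow> \<exists>i\<in>J. 0 < f i \<bullet> x"
begin

definition V :: "'a \<Rightarrow> real" where
  "V x = Max ((\<lambda>i. f i \<bullet> x) ` J)"

definition active :: "'a \<Rightarrow> nat set" where
  "active x = {i \<in> J. f i \<bullet> x = V x}"

definition slope :: real where
  "slope = (\<Sum>i\<in>J. norm (f i))"

lemma facet_le_V: "i \<in> J \<Longrightarrow> f i \<bullet> x \<le> V x"
  unfolding V_def using finite_J by (intro Max_ge) auto

lemma V_leI: "(\<And>i. i \<in> J \<Longrightarrow> f i \<bullet> x \<le> r) \<Longrightarrow> V x \<le> r"
  unfolding V_def using finite_J J_nonempty by (subst Max_le_iff) auto

lemma active_nonempty: "active x \<noteq> {}"
proof -
  have "V x \<in> (\<lambda>i. f i \<bullet> x) ` J"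
    unfolding V_def using finite_J J_nonempty by (intro Max_in) auto
  then show ?thesis by (auto simp: active_def)
qed

lemma active_facet: "i \<in> active x \<Longrightarrow> f i \<bullet> x = V x"
  by (simp add: active_def)

lemma active_subset: "active x \<subseteq> J"
  by (auto simp: active_def)

lemma finite_active: "finite (active x)"
  using active_subset finite_J finite_subset by blast

lemma V_pos: "x \<noteq> 0 \<Longrightarrow> 0 < V x"
  using positive facet_le_V by (meson less_le_trans)

lemma V_0: "V 0 = 0"
  using active_nonempty[of 0] active_facet[of _ 0] by force

lemma V_add_le: "V (x + y) \<le> V x + V y"
  by (rule V_leI) (simp add: inner_add_right add_mono facet_le_V)

lemma V_scaleR:
  assumes "0 \<le> r" shows "V (r *\<^sub>R x) = r * V x"
proof (rule antisym)
  show "V (r *\<^sub>R x) \<le> r * V x"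
    by (rule V_leI) (simp add: mult_left_mono facet_le_V assms)
  obtain i where "i \<in> active x" using active_nonempty by blast
  then show "r * V x \<le> V (r *\<^sub>R x)"
    using facet_le_V[of i "r *\<^sub>R x"] active_facet active_subset by force
qed

lemma V_le_norm: "V x \<le> slope * norm x"
proof (rule V_leI)
  fix i assume "i \<in> J"
  then have "norm (f i) \<le> slope"
    unfolding slope_def using finite_J by (intro member_le_sum) auto
  then show "f i \<bullet> x \<le> slope * norm x"
    by (meson norm_cauchy_schwarz norm_ge_zero mult_right_mono order_trans)
qed

lemma slope_nonneg: "0 \<le> slope"
  by (simp add: slope_def sum_nonneg)

lemma V_diff_le: "V x - V y \<le> slope * norm (x - y)"
  using V_add_le[of "x - y" y] V_le_norm[of "x - y"] by simp

lemma continuous_V: "continuous_on UNIV V"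
proof (rule continuous_on_subset[OF lipschitz_on_continuous_on])
  show "slope-lipschitz_on UNIV V"
  proof (rule lipschitz_onI)
    fix x y show "dist (V x) (V y) \<le> slope * dist x y"
      using V_diff_le[of x y] V_diff_le[of y x]
      by (auto simp: dist_real_def dist_norm abs_le_iff norm_minus_commute)
  qed (rule slope_nonneg)
qed simp

lemma tendsto_V: "(u \<longlongrightarrow> z) F \<Longrightarrow> ((\<lambda>t. V (u t)) \<longlongrightarrow> V z) F"
  using continuous_on_tendsto_compose[OF continuous_V] by auto

text \<open>By homogeneity it suffices to take the minimum of \<open>V\<close> over the unit sphere.\<close>

lemma norm_le_V: "\<exists>m>0. \<forall>x. m * norm x \<le> V x"
proof -
  have ne: "sphere (0::'a) 1 \<noteq> {}"
    by (auto intro: vector_choose_size[of 1])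
  obtain e where e: "e \<in> sphere 0 1" "\<And>x. x \<in> sphere 0 1 \<Longrightarrow> V e \<le> V x"
    using continuous_attains_inf[OF compact_sphere ne continuous_on_subset[OF continuous_V subset_UNIV]]
    by blast
  have "V e * norm x \<le> V x" for x
  proof (cases "x = 0")
    case False
    have "V x = norm x * V (x /\<^sub>R norm x)"
      using V_scaleR[of "norm x" "x /\<^sub>R norm x"] False by simp
    moreover have "V e \<le> V (x /\<^sub>R norm x)" using e(2) False by simp
    ultimately show ?thesis by (simp add: mult.commute mult_left_mono)
  qed (simp add: V_0)
  moreover have "V e > 0" using e(1) by (intro V_pos) auto
  ultimately show ?thesis by blast
qed

text \<open>Strict inequalities between finitely many continuous functions persist nearby, so inactive
  functionals stay inactive.\<close>

lemma active_nearby: "\<forall>\<^sub>F y in nhds z. active y \<subseteq> active z"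
proof -
  have "\<forall>\<^sub>F y in nhds z. f i \<bullet> y < V y" if "i \<in> J - active z" for i
  proof -
    have "((\<lambda>y. V y - f i \<bullet> y) \<longlongrightarrow> V z - f i \<bullet> z) (nhds z)"
      by (intro tendsto_intros tendsto_V filterlim_ident)
    moreover have "0 < V z - f i \<bullet> z" using that facet_le_V[of i z] by (auto simp: active_def)
    ultimately have "\<forall>\<^sub>F y in nhds z. 0 < V y - f i \<bullet> y" by (rule order_tendstoD(1))
    then show ?thesis by eventually_elim simp
  qed
  then have "\<forall>\<^sub>F y in nhds z. \<forall>i\<in>J - active z. f i \<bullet> y < V y"
    using finite_J by (intro eventually_ball_finite) auto
  then show ?thesis by eventually_elim (force simp: active_def)
qed

text \<open>This is where polyhedrality enters: the first-order conditions at the active functionals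
  already guarantee a whole feasible step, since the inactive ones have slack. For a general convex
  \<open>V\<close>, such as the Euclidean norm with a rotation field, this fails.\<close>

lemma feasible_direction:
  assumes "\<And>i. i \<in> active x \<Longrightarrow> f i \<bullet> v \<le> 0"
  shows "\<forall>\<^sub>F h in at_right 0. V (x + h *\<^sub>R v) \<le> V x"
proof -
  have "\<forall>\<^sub>F h in at_right 0. f i \<bullet> (x + h *\<^sub>R v) \<le> V x" if "i \<in> J" for i
  proof (cases "i \<in> active x")
    case True
    then show ?thesis
      using assms[OF True] active_facet[OF True]
      by (intro eventually_at_right_less[THEN eventually_mono])
         (simp add: inner_add_right mult_nonneg_nonpos)
  next
    case False
    then have "f i \<bullet> x < V x" using that facet_le_V[of i x] by (auto simp: active_def)
    moreover have "((\<lambda>h. f i \<bullet> (x + h *\<^sub>R v)) \<longlongrightarrow> f i \<bullet> (x + 0 *\<^sub>R v)) (at_right 0)"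
      by (intro tendsto_intros)
    ultimately have "\<forall>\<^sub>F h in at_right 0. f i \<bullet> (x + h *\<^sub>R v) < V x"
      by (intro order_tendstoD(2)[of _ "f i \<bullet> x"]) auto
    then show ?thesis by eventually_elim simp
  qed
  then have "\<forall>\<^sub>F h in at_right 0. \<forall>i\<in>J. f i \<bullet> (x + h *\<^sub>R v) \<le> V x"
    using finite_J by (intro eventually_ball_finite) auto
  then show ?thesis by eventually_elim (auto intro: V_leI)
qed

text \<open>The difference quotients of \<open>V\<close> dominate those of any active functional.\<close>

lemma Dini_active:
  assumes lim: "Limsup (at_right 0) (\<lambda>h. ereal ((V (x + h *\<^sub>R v) - V x) / h)) \<le> 0"
    and i: "i \<in> active x"
  shows "f i \<bullet> v \<le> 0"
proof -
  have "ereal (f i \<bullet> v) \<le> Limsup (at_right 0) (\<lambda>h. ereal ((V (x + h *\<^sub>R v) - V x) / h))"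
  proof (rule le_Limsup)
    show "\<forall>\<^sub>F h in at_right 0. ereal (f i \<bullet> v) \<le> ereal ((V (x + h *\<^sub>R v) - V x) / h)"
    proof (rule eventually_at_right_less[THEN eventually_mono])
      fix h :: real assume "0 < h"
      moreover have "f i \<bullet> (x + h *\<^sub>R v) \<le> V (x + h *\<^sub>R v)"
        using i active_subset by (intro facet_le_V) auto
      ultimately show "ereal (f i \<bullet> v) \<le> ereal ((V (x + h *\<^sub>R v) - V x) / h)"
        using active_facet[OF i] by (simp add: inner_add_right field_simps)
    qed
  qed simp
  then have "ereal (f i \<bullet> v) \<le> 0" using lim by (rule order_trans)
  then show ?thesis by simp
qed

text \<open>The zero of \<open>B\<close> is found on the face \<open>F\<close> cut out by the functionals active at \<open>z\<close>. Because \<open>z\<close> lies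
  in the relative interior of \<open>F\<close>, from any \<open>y \<in> F\<close> one can continue a little beyond \<open>z\<close> without
  leaving \<open>F\<close>; both end points satisfy \<open>f i \<bullet> B _ \<le> 0\<close> and the value at \<open>z\<close> in between is \<open>0\<close>, so
  \<open>f i \<bullet> B y = 0\<close>. Thus \<open>B\<close> points into \<open>F\<close> on all of \<open>F\<close>, and separating \<open>0\<close> from \<open>B ` F\<close> is
  impossible. Linearity of \<open>B\<close> makes \<open>B ` F\<close> convex, so that separation replaces a fixed point
  theorem.\<close>

lemma kernel_on_invariant_face:
  assumes B: "linear B"
    and nonexp: "\<And>x i. i \<in> active x \<Longrightarrow> f i \<bullet> B x \<le> 0"
    and z: "z \<noteq> 0" and tangent: "\<And>i. i \<in> active z \<Longrightarrow> f i \<bullet> B z = 0"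
  shows "\<exists>y. y \<noteq> 0 \<and> B y = 0"
proof -
  define F where "F = {y. (\<forall>i\<in>J. f i \<bullet> y \<le> V z) \<and> (\<forall>i\<in>active z. f i \<bullet> y = V z)}"
  have c: "V z > 0" using V_pos z .
  have zF: "z \<in> F" by (auto simp: F_def facet_le_V active_facet)
  have VF: "V y = V z" if "y \<in> F" for y
  proof (rule antisym)
    show "V y \<le> V z" using that by (intro V_leI) (auto simp: F_def)
    obtain i where "i \<in> active z" using active_nonempty by blast
    then show "V z \<le> V y" using that facet_le_V[of i y] active_subset by (auto simp: F_def)
  qed
  have F_alt: "F = (\<Inter>i\<in>J. {y. f i \<bullet> y \<le> V z}) \<inter> (\<Inter>i\<in>active z. {y. f i \<bullet> y = V z})"
    by (auto simp: F_def)
  have "convex F" unfolding F_alt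
    by (intro convex_Int convex_INT convex_halfspace_le convex_hyperplane)
  have "closed F" unfolding F_alt
    by (intro closed_Int closed_INT ballI closed_halfspace_le closed_hyperplane)
  obtain m where m: "m > 0" "\<And>x. m * norm x \<le> V x" using norm_le_V by blast
  have "bounded F"
    unfolding bounded_iff
  proof (intro exI ballI)
    fix y assume "y \<in> F"
    then show "norm y \<le> V z / m" using m(1) m(2)[of y] VF by (simp add: field_simps)
  qed
  with \<open>closed F\<close> have "compact F" by (simp add: compact_eq_bounded_closed)
  have face_tangent: "f i \<bullet> B y = 0" if i: "i \<in> active z" and y: "y \<in> F" for i y
  proof -
    \<comment> \<open>The point \<open>z + h (z - y)\<close> lies beyond \<open>z\<close> as seen from \<open>y\<close>.\<close>
    have "\<forall>\<^sub>F h in at_right 0. \<forall>j\<in>J. f j \<bullet> (z + h *\<^sub>R (z - y)) \<le> V z"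
    proof -
      have "\<forall>\<^sub>F h in at_right 0. V (z + h *\<^sub>R (z - y)) \<le> V z"
        using y by (intro feasible_direction) (auto simp: F_def inner_diff_right active_facet)
      then show ?thesis by eventually_elim (meson facet_le_V order_trans)
    qed
    then have "\<forall>\<^sub>F h in at_right 0. (\<forall>j\<in>J. f j \<bullet> (z + h *\<^sub>R (z - y)) \<le> V z) \<and> (0::real) < h"
      using eventually_at_right_less by (rule eventually_conj)
    then obtain h :: real where h: "\<forall>j\<in>J. f j \<bullet> (z + h *\<^sub>R (z - y)) \<le> V z" "0 < h"
      using eventually_happens by force
    let ?u = "z + h *\<^sub>R (z - y)"
    have u: "?u \<in> F" using h y
      by (auto simp: F_def inner_add_right inner_diff_right active_facet)
    have iJ: "i \<in> J" using i active_subset by auto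
    have "i \<in> active ?u" "i \<in> active y"
      using i iJ VF[OF u] VF[OF y] u y unfolding active_def[of ?u] active_def[of y] by (simp_all add: F_def)
    then have "f i \<bullet> B ?u \<le> 0" "f i \<bullet> B y \<le> 0" using nonexp by auto
    moreover have "f i \<bullet> B ?u = - h * (f i \<bullet> B y)"
      using tangent[OF i]
      by (simp add: linear_add[OF B] linear_cmul[OF B] linear_diff[OF B] inner_add_right inner_diff_right)
    ultimately show ?thesis using h(2)
      by (simp add: zero_le_mult_iff mult_le_0_iff)
  qed
  show ?thesis
  proof (rule ccontr)
    assume "\<not> ?thesis"
    then have no_zero: "0 \<notin> B ` F" using VF V_0 c by (metis imageE less_irrefl)
    have "convex (B ` F)" using B \<open>convex F\<close> by (rule convex_linear_image)
    moreover have "closed (B ` F)"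
      using B \<open>compact F\<close> by (intro compact_imp_closed compact_continuous_image linear_continuous_on)
        (auto simp: linear_conv_bounded_linear)
    ultimately obtain p b where p: "b > 0" "\<And>y. y \<in> F \<Longrightarrow> p \<bullet> B y > b"
      using separating_hyperplane_closed_0[of "B ` F"] no_zero by blast
    obtain y where y: "y \<in> F" "\<And>u. u \<in> F \<Longrightarrow> p \<bullet> u \<le> p \<bullet> y"
      using continuous_attains_sup[OF \<open>compact F\<close> _ continuous_on_inner[OF continuous_on_const continuous_on_id]] zF
      by blast
    \<comment> \<open>A small step along \<open>B\<close> from the maximiser \<open>y\<close> of \<open>p\<close> stays in \<open>F\<close> but increases \<open>p\<close>.\<close>
    have "\<forall>\<^sub>F h in at_right 0. V (y + h *\<^sub>R B y) \<le> V y \<and> (0::real) < h"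
      using nonexp by (intro eventually_conj feasible_direction eventually_at_right_less)
    then obtain h :: real where h: "V (y + h *\<^sub>R B y) \<le> V y" "0 < h"
      using eventually_happens by force
    have "f i \<bullet> (y + h *\<^sub>R B y) \<le> V z" if "i \<in> J" for i
      using facet_le_V[OF that, of "y + h *\<^sub>R B y"] h(1) VF[OF y(1)] by linarith
    moreover have "f i \<bullet> (y + h *\<^sub>R B y) = V z" if "i \<in> active z" for i
      using y(1) face_tangent[OF that y(1)] that by (simp add: F_def inner_add_right)
    ultimately have "y + h *\<^sub>R B y \<in> F" by (simp add: F_def)
    then have "p \<bullet> (y + h *\<^sub>R B y) \<le> p \<bullet> y" by (rule y(2))
    then have "p \<bullet> B y \<le> 0" using h(2) by (simp add: inner_add_right mult_le_0_iff)
    then show False using p y(1) by force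
  qed
qed

lemma active_sum_decreases:
  assumes "linear B" "\<And>x i. i \<in> active x \<Longrightarrow> f i \<bullet> B x \<le> 0"
    and "\<And>y. B y = 0 \<Longrightarrow> y = 0" "z \<noteq> 0"
  shows "(\<Sum>i\<in>active z. f i) \<bullet> B z < 0"
proof -
  obtain i where i: "i \<in> active z" "f i \<bullet> B z \<noteq> 0"
    using kernel_on_invariant_face[OF assms(1,2,4)] assms(3) by blast
  then have "f i \<bullet> B z < 0" using assms(2)[OF i(1)] by simp
  then have "(\<Sum>i\<in>active z. f i \<bullet> B z) < (\<Sum>i\<in>active z. 0)"
    using i(1) assms(2) finite_active by (intro sum_strict_mono_ex1) auto
  then show ?thesis by (simp add: inner_sum_left)
qed

lemma active_sum_value: "(\<Sum>i\<in>active z. f i) \<bullet> z = real (card (active z)) * V z"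
  by (simp add: inner_sum_left active_facet)

end

section \<open>The simplex of weights and estimates along solutions\<close>

lemma abs_continuous_on_interval_subset:
  assumes "abs_continuous_on_interval a b x" "{a'..b'} \<subseteq> {a..b}"
  shows "abs_continuous_on_interval a' b' x"
  using assms unfolding abs_continuous_on_interval_def by (meson subset_trans)

lemma vector_derivative_approx:
  assumes "(x has_vector_derivative v) (at t within S)" "e > 0"
  shows "\<exists>d>0. \<forall>s\<in>S. \<bar>s - t\<bar> < d \<longrightarrow> norm (x s - (x t + (s - t) *\<^sub>R v)) \<le> e * \<bar>s - t\<bar>"
  using assms unfolding has_vector_derivative_def has_derivative_within_alt
  by (auto simp: algebra_simps)

lemma small_factor:
  fixes e K :: real
  assumes "e > 0" "K \<ge> 0"
  obtains e' where "e' > 0" "K * e' \<le> e"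
proof
  have "K + 1 > 0" using assms by simp
  then show "e / (K + 1) > 0" "K * (e / (K + 1)) \<le> e"
    using assms by (simp_all add: field_simps)
qed

lemma compact_weight_simplex: "compact (weight_simplex :: (real ^ 'm::finite) set)"
proof -
  have "bounded (weight_simplex :: (real ^ 'm) set)"
    unfolding bounded_iff
  proof (intro exI ballI)
    fix w :: "real ^ 'm" assume w: "w \<in> weight_simplex"
    have "norm w \<le> (\<Sum>i\<in>UNIV. \<bar>w $ i\<bar>)" by (rule norm_le_l1_cart)
    also have "\<dots> = 1" using w by (simp add: weight_simplex_def)
    finally show "norm w \<le> 1" .
  qed
  moreover have "closed (weight_simplex :: (real ^ 'm) set)"
    unfolding weight_simplex_def
    by (intro closed_Collect_conj closed_Collect_eq closed_Collect_all closed_Collect_le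
        continuous_intros)
  ultimately show ?thesis by (simp add: compact_eq_bounded_closed)
qed

lemma weight_simplex_nonempty: "axis i 1 \<in> (weight_simplex :: (real ^ 'm::finite) set)"
  by (auto simp: weight_simplex_def axis_def)

lemma weighted_matrix_mult_vec:
  "weighted_matrix A w *v x = (\<Sum>i\<in>UNIV. w $ i *\<^sub>R (A i *v x))"
proof -
  have "(\<Sum>i\<in>S. w $ i *\<^sub>R A i) *v x = (\<Sum>i\<in>S. w $ i *\<^sub>R (A i *v x))" for S
    by (induction S rule: infinite_finite_induct)
       (simp_all add: matrix_vector_mult_add_rdistrib scaleR_matrix_vector_assoc)
  then show ?thesis unfolding weighted_matrix_def .
qed

lemma weighted_matrix_bound:
  fixes A :: "'m::finite \<Rightarrow> real ^ 'n ^ 'n"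
  shows "\<exists>K\<ge>0. \<forall>w\<in>weight_simplex. \<forall>x. norm (weighted_matrix A w *v x) \<le> K * norm x"
proof (intro exI conjI ballI allI)
  define K where "K = (\<Sum>i\<in>UNIV. onorm ((*v) (A i)))"
  have on: "0 \<le> onorm ((*v) (A i))" for i
    by (intro onorm_pos_le matrix_vector_mul_bounded_linear)
  then show "0 \<le> K" unfolding K_def by (simp add: sum_nonneg)
  fix w :: "real ^ 'm" and x :: "real ^ 'n" assume w: "w \<in> weight_simplex"
  have w1: "w $ i \<le> 1" for i
    using w member_le_sum[of i UNIV "\<lambda>i. w $ i"] by (auto simp: weight_simplex_def)
  have "norm (weighted_matrix A w *v x) \<le> (\<Sum>i\<in>UNIV. norm (w $ i *\<^sub>R (A i *v x)))"
    unfolding weighted_matrix_mult_vec by (rule norm_sum)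
  also have "\<dots> \<le> (\<Sum>i\<in>UNIV. onorm ((*v) (A i)) * norm x)"
  proof (rule sum_mono)
    fix i
    have "norm (w $ i *\<^sub>R (A i *v x)) \<le> 1 * norm (A i *v x)"
      using w w1[of i] by (simp add: weight_simplex_def mult_left_le_one_le)
    also have "\<dots> \<le> onorm ((*v) (A i)) * norm x"
      using onorm[OF matrix_vector_mul_bounded_linear[of "A i"]] by simp
    finally show "norm (w $ i *\<^sub>R (A i *v x)) \<le> onorm ((*v) (A i)) * norm x" .
  qed
  finally show "norm (weighted_matrix A w *v x) \<le> K * norm x"
    by (simp add: K_def sum_distrib_right)
qed

lemma inclusion_solution_negligible:
  assumes "inclusion_solution A w x0 x"
  shows "\<exists>N. negligible N \<and> (\<forall>t\<ge>0. t \<notin> N \<longrightarrow>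
     (x has_vector_derivative (weighted_matrix A (w t) *v x t)) (at t within {0..}))"
proof -
  let ?P = "\<lambda>t. (x has_vector_derivative (weighted_matrix A (w t) *v x t)) (at t within {0..})"
  have "AE t in lebesgue_on {0..}. ?P t"
    using assms by (simp add: inclusion_solution_def)
  then have "AE t in lebesgue. t \<in> {0..} \<longrightarrow> ?P t"
    by (subst (asm) AE_restrict_space_iff) auto
  then obtain N where "N \<in> null_sets lebesgue" "{t \<in> space lebesgue. \<not> (t \<in> {0..} \<longrightarrow> ?P t)} \<subseteq> N"
    using eventually_ae_filter[of _ lebesgue] by (auto simp: eventually_ae_filter)
  then show ?thesis
    by (intro exI[of _ N]) (auto simp: negligible_iff_null_sets)
qed

lemma inclusion_solution_abs_continuous:
  assumes "inclusion_solution A w x0 x" "0 \<le> a" "a \<le> b"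
  shows "abs_continuous_on_interval a b x"
  using assms by (auto simp: inclusion_solution_def
      intro: abs_continuous_on_interval_subset[of 0 b])

text \<open>All information about solutions that the convergence proof uses comes from this lemma and from the
  monotonicity of \<open>V\<close>. In particular it gives the Lipschitz bound below, by testing the increment
  against itself.\<close>

lemma linear_functional_increment_le:
  assumes sol: "inclusion_solution A w x0 x" and ab: "0 \<le> a" "a \<le> b"
    and le: "\<And>t. t \<in> {a..b} \<Longrightarrow> p \<bullet> (weighted_matrix A (w t) *v x t) \<le> c"
  shows "p \<bullet> x b - p \<bullet> x a \<le> c * (b - a)"
proof -
  obtain N where N: "negligible N" and der: "\<And>t. \<lbrakk>0 \<le> t; t \<notin> N\<rbrakk> \<Longrightarrow>
     (x has_vector_derivative (weighted_matrix A (w t) *v x t)) (at t within {0..})"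
    using inclusion_solution_negligible[OF sol] by blast
  show ?thesis
  proof (rule increment_le_of_local_bounds[OF ab(2) N inclusion_solution_abs_continuous[OF sol ab]])
    show "p \<bullet> x v - p \<bullet> x u \<le> norm p * norm (x v - x u)" for u v
      using norm_cauchy_schwarz[of p "x v - x u"] by (simp add: inner_diff_right)
  next
    fix t e :: real assume t: "t \<in> {a..b} - N" and e: "e > 0"
    let ?v = "weighted_matrix A (w t) *v x t"
    obtain e' where e': "e' > 0" "norm p * e' \<le> e"
      using small_factor[OF e norm_ge_zero] by blast
    have "(x has_vector_derivative ?v) (at t within {0..})"
      using der t ab by auto
    then obtain d where d: "d > 0" "\<And>s. \<lbrakk>s \<ge> 0; \<bar>s - t\<bar> < d\<rbrakk> \<Longrightarrow>
        norm (x s - (x t + (s - t) *\<^sub>R ?v)) \<le> e' * \<bar>s - t\<bar>"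
      using vector_derivative_approx[OF _ e'(1)] by (metis atLeast_iff)
    have bound: "\<bar>p \<bullet> x s - p \<bullet> x t - (s - t) * (p \<bullet> ?v)\<bar> \<le> e * \<bar>s - t\<bar>"
      if "s \<ge> 0" "\<bar>s - t\<bar> < d" for s
    proof -
      have "\<bar>p \<bullet> (x s - (x t + (s - t) *\<^sub>R ?v))\<bar> \<le> norm p * (e' * \<bar>s - t\<bar>)"
        using d(2)[OF that] Cauchy_Schwarz_ineq2[of p] by (meson mult_left_mono norm_ge_zero order_trans)
      also have "\<dots> \<le> e * \<bar>s - t\<bar>"
        using mult_right_mono[OF e'(2), of "\<bar>s - t\<bar>"] by (simp add: mult.assoc)
      finally show ?thesis by (simp add: inner_diff_right inner_add_right algebra_simps)
    qed
    show "\<exists>d>0. \<forall>u\<in>{a..b}. \<forall>v\<in>{a..b}. t - d < u \<longrightarrow> u \<le> t \<longrightarrow> t \<le> v \<longrightarrow> v < t + d \<longrightarrow>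
          p \<bullet> x v - p \<bullet> x u \<le> (c + e) * (v - u)"
    proof (intro exI[of _ d] conjI ballI impI d(1))
      fix u v assume uv: "u \<in> {a..b}" "v \<in> {a..b}" "t - d < u" "u \<le> t" "t \<le> v" "v < t + d"
      have "p \<bullet> x v - p \<bullet> x t - (v - t) * (p \<bullet> ?v) \<le> e * (v - t)"
        using bound[of v] uv ab by auto
      moreover have "(t - u) * - (p \<bullet> ?v) + (p \<bullet> x t - p \<bullet> x u) \<le> e * (t - u)"
        using bound[of u] uv ab by (auto simp: algebra_simps)
      moreover have "(v - u) * (p \<bullet> ?v) \<le> (v - u) * c"
        using le[of t] t uv by (intro mult_left_mono) auto
      ultimately show "p \<bullet> x v - p \<bullet> x u \<le> (c + e) * (v - u)"
        by (simp add: algebra_simps)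
    qed
  qed
qed

lemma solution_Lipschitz:
  assumes sol: "inclusion_solution A w x0 x"
    and bd: "\<And>t. 0 \<le> t \<Longrightarrow> norm (weighted_matrix A (w t) *v x t) \<le> L"
    and ab: "0 \<le> a" "a \<le> b"
  shows "norm (x b - x a) \<le> L * (b - a)"
proof -
  let ?p = "x b - x a"
  have "?p \<bullet> x b - ?p \<bullet> x a \<le> (norm ?p * L) * (b - a)"
  proof (rule linear_functional_increment_le[OF sol ab])
    fix t assume "t \<in> {a..b}"
    then show "?p \<bullet> (weighted_matrix A (w t) *v x t) \<le> norm ?p * L"
      using bd[of t] ab norm_cauchy_schwarz[of ?p "weighted_matrix A (w t) *v x t"]
        mult_left_mono[of "norm (weighted_matrix A (w t) *v x t)" L "norm ?p"] by auto
  qed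
  then have "norm ?p * norm ?p \<le> norm ?p * (L * (b - a))"
    by (simp add: inner_diff_right[symmetric] power2_norm_eq_inner[symmetric] power2_eq_square mult.assoc)
  moreover have "0 \<le> L * (b - a)"
    using bd[of a] ab norm_ge_zero order_trans by (intro mult_nonneg_nonneg) (blast, simp)
  ultimately show ?thesis
    by (cases "?p = 0") (simp_all add: mult_le_cancel_left_pos)
qed

section \<open>Convergence under robust non-singularity\<close>

locale weak_polyhedral_system = polyhedral_gauge J f
  for J :: "nat set" and f :: "nat \<Rightarrow> real ^ 'n::finite" +
  fixes A :: "'m::finite \<Rightarrow> real ^ 'n ^ 'n"
  assumes active_nonincreasing:
    "\<lbrakk>w \<in> weight_simplex; i \<in> active x\<rbrakk> \<Longrightarrow> f i \<bullet> (weighted_matrix A w *v x) \<le> 0"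
begin

text \<open>At a point of differentiability with velocity \<open>v\<close>, the line \<open>x t + h v\<close> satisfies
  \<open>V (x t + h v) \<le> V (x t)\<close> for small \<open>h \<ge> 0\<close>. The comparison principle also needs the past, and
  there convexity gives \<open>V (x t - h v) \<ge> V (x t)\<close>. Since \<open>V\<close> is Lipschitz, the same holds along
  the solution up to a small multiple of the elapsed time.\<close>

lemma V_antimono_along_solution:
  assumes adm: "admissible_signal w" and sol: "inclusion_solution A w x0 x" and ab: "0 \<le> a" "a \<le> b"
  shows "V (x b) \<le> V (x a)"
proof -
  obtain N where N: "negligible N" and der: "\<And>t. \<lbrakk>0 \<le> t; t \<notin> N\<rbrakk> \<Longrightarrow>
     (x has_vector_derivative (weighted_matrix A (w t) *v x t)) (at t within {0..})"
    using inclusion_solution_negligible[OF sol] by blast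
  have "V (x b) - V (x a) \<le> 0 * (b - a)"
  proof (rule increment_le_of_local_bounds[OF ab(2) N inclusion_solution_abs_continuous[OF sol ab]])
    show "V (x v) - V (x u) \<le> slope * norm (x v - x u)" for u v
      by (rule V_diff_le)
  next
    fix t e :: real assume t: "t \<in> {a..b} - N" and e: "e > 0"
    let ?v = "weighted_matrix A (w t) *v x t"
    obtain e' where e': "e' > 0" "slope * e' \<le> e"
      using small_factor[OF e slope_nonneg] by blast
    have "(x has_vector_derivative ?v) (at t within {0..})"
      using der t ab by auto
    then obtain d where d: "d > 0" "\<And>s. \<lbrakk>s \<ge> 0; \<bar>s - t\<bar> < d\<rbrakk> \<Longrightarrow>
        norm (x s - (x t + (s - t) *\<^sub>R ?v)) \<le> e' * \<bar>s - t\<bar>"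
      using vector_derivative_approx[OF _ e'(1)] by (metis atLeast_iff)
    have bound: "slope * norm (x s - (x t + (s - t) *\<^sub>R ?v)) \<le> e * \<bar>s - t\<bar>"
      if "s \<ge> 0" "\<bar>s - t\<bar> < d" for s
    proof -
      have "slope * norm (x s - (x t + (s - t) *\<^sub>R ?v)) \<le> slope * (e' * \<bar>s - t\<bar>)"
        using d(2)[OF that] slope_nonneg by (rule mult_left_mono)
      also have "\<dots> \<le> e * \<bar>s - t\<bar>"
        using mult_right_mono[OF e'(2), of "\<bar>s - t\<bar>"] by (simp add: mult.assoc)
      finally show ?thesis .
    qed
    have "w t \<in> weight_simplex" using adm t ab by (auto simp: admissible_signal_def)
    then have "\<forall>\<^sub>F h in at_right 0. V (x t + h *\<^sub>R ?v) \<le> V (x t)"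
      by (intro feasible_direction active_nonincreasing)
    then obtain h0 where h0: "h0 > 0" "\<And>h. \<lbrakk>0 < h; h < h0\<rbrakk> \<Longrightarrow> V (x t + h *\<^sub>R ?v) \<le> V (x t)"
      unfolding eventually_at_right_field by blast
    have forward: "V (x t + h *\<^sub>R ?v) \<le> V (x t)" if "0 \<le> h" "h < h0" for h
      using h0(2)[of h] that by (cases "h = 0") auto
    have backward: "V (x t) \<le> V (x t - h *\<^sub>R ?v)" if "0 \<le> h" "h < h0" for h
    proof -
      have "2 * V (x t) = V (2 *\<^sub>R x t)" by (simp add: V_scaleR)
      also have "2 *\<^sub>R x t = (x t + h *\<^sub>R ?v) + (x t - h *\<^sub>R ?v)" by (simp add: scaleR_2)
      also have "V \<dots> \<le> V (x t + h *\<^sub>R ?v) + V (x t - h *\<^sub>R ?v)" by (rule V_add_le)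
      finally show ?thesis using forward[OF that] by simp
    qed
    show "\<exists>d>0. \<forall>u\<in>{a..b}. \<forall>v\<in>{a..b}. t - d < u \<longrightarrow> u \<le> t \<longrightarrow> t \<le> v \<longrightarrow> v < t + d \<longrightarrow>
          V (x v) - V (x u) \<le> (0 + e) * (v - u)"
    proof (intro exI[of _ "min d h0"] conjI ballI impI)
      show "min d h0 > 0" using d(1) h0(1) by simp
      fix u v assume uv: "u \<in> {a..b}" "v \<in> {a..b}" "t - min d h0 < u" "u \<le> t" "t \<le> v" "v < t + min d h0"
      have near: "\<bar>v - t\<bar> < d" "v - t < h0" "\<bar>u - t\<bar> < d" "t - u < h0" using uv by linarith+
      have "V (x v) - V (x t + (v - t) *\<^sub>R ?v) \<le> e * (v - t)"
        using near bound[of v] V_diff_le[of "x v" "x t + (v - t) *\<^sub>R ?v"] uv ab by auto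
      moreover have "V (x t - (t - u) *\<^sub>R ?v) - V (x u) \<le> e * (t - u)"
        using near bound[of u] V_diff_le[of "x t - (t - u) *\<^sub>R ?v" "x u"] uv ab
        by (auto simp: norm_minus_commute algebra_simps)
      ultimately show "V (x v) - V (x u) \<le> (0 + e) * (v - u)"
        using near forward[of "v - t"] backward[of "t - u"] uv by (simp add: algebra_simps)
    qed
  qed
  then show ?thesis by simp
qed

text \<open>The active set is fixed to that of the centre \<open>z\<close>. Active sets of points \<open>y\<close> near \<open>z\<close> may be
  smaller, but for the one linear functional \<open>\<Sum>i\<in>active z. f i\<close> the decrease at \<open>z\<close>, uniform over
  the compact simplex, extends to a ball by continuity.\<close>

lemma uniform_active_decrease:
  assumes ker: "weak_kernel A = {0}" and z: "z \<noteq> 0"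
  shows "\<exists>\<delta>>0. \<exists>\<rho>>0. \<forall>w\<in>weight_simplex. \<forall>y. norm (y - z) < \<rho> \<longrightarrow>
     (\<Sum>i\<in>active z. f i) \<bullet> (weighted_matrix A w *v y) \<le> - \<delta>"
proof -
  let ?p = "\<Sum>i\<in>active z. f i"
  obtain K where K: "K \<ge> 0" "\<And>w x. w \<in> weight_simplex \<Longrightarrow> norm (weighted_matrix A w *v x) \<le> K * norm x"
    using weighted_matrix_bound[of A] by blast
  have cont: "continuous_on weight_simplex (\<lambda>w. ?p \<bullet> (weighted_matrix A w *v z))"
    unfolding weighted_matrix_mult_vec by (intro continuous_intros)
  have "weight_simplex \<noteq> ({} :: (real ^ 'm) set)" using weight_simplex_nonempty by blast
  then obtain v where v: "v \<in> weight_simplex"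
    and max: "\<And>w. w \<in> weight_simplex \<Longrightarrow> ?p \<bullet> (weighted_matrix A w *v z) \<le> ?p \<bullet> (weighted_matrix A v *v z)"
    using continuous_attains_sup[OF compact_weight_simplex _ cont] by auto
  have neg: "?p \<bullet> (weighted_matrix A v *v z) < 0"
  proof (rule active_sum_decreases[OF matrix_vector_mul_linear active_nonincreasing[OF v] _ z])
    show "y = 0" if "weighted_matrix A v *v y = 0" for y
      using ker that v by (auto simp: weak_kernel_def)
  qed
  define \<delta> where "\<delta> = - (?p \<bullet> (weighted_matrix A v *v z)) / 2"
  define \<rho> where "\<rho> = \<delta> / (norm ?p * K + 1)"
  have pos: "\<delta> > 0" "norm ?p * K + 1 > 0" using neg K(1) by (auto simp: \<delta>_def add_nonneg_pos)
  show ?thesis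
  proof (rule exI[of _ \<delta>], rule conjI[OF pos(1)], rule exI[of _ \<rho>], intro conjI ballI allI impI)
    show "\<rho> > 0" using pos by (simp add: \<rho>_def)
    fix w :: "real ^ 'm" and y assume w: "w \<in> weight_simplex" and y: "norm (y - z) < \<rho>"
    have "?p \<bullet> (weighted_matrix A w *v (y - z)) \<le> norm ?p * (K * norm (y - z))"
      using norm_cauchy_schwarz K(2)[OF w] by (meson mult_left_mono norm_ge_zero order_trans)
    also have "\<dots> \<le> (norm ?p * K + 1) * \<rho>"
      using y K(1) by (subst mult.assoc[symmetric]) (intro mult_mono, auto)
    also have "\<dots> = \<delta>" using pos by (simp add: \<rho>_def)
    finally have "?p \<bullet> (weighted_matrix A w *v y) \<le> ?p \<bullet> (weighted_matrix A w *v z) + \<delta>"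
      by (simp add: matrix_vector_mult_diff_distrib inner_diff_right)
    then show "?p \<bullet> (weighted_matrix A w *v y) \<le> - \<delta>"
      using max[OF w] by (simp add: \<delta>_def)
  qed
qed

text \<open>Minimality of the active set at \<open>z\<close> makes \<open>\<Sum>i\<in>active z. f i\<close> constant on the limit points near
  \<open>z\<close>. The states at the times \<open>\<tau> k\<close> and \<open>\<tau> k + h\<close> accumulate at such limit points, while
  the sum drops by at least \<open>\<delta> h\<close> in between, whatever the signal does.\<close>

lemma solution_tendsto_0:
  assumes ker: "weak_kernel A = {0}"
    and adm: "admissible_signal w" and sol: "inclusion_solution A w x0 x"
  shows "(x \<longlongrightarrow> 0) at_top"
proof (rule ccontr)
  assume not0: "\<not> (x \<longlongrightarrow> 0) at_top"
  have w: "w t \<in> weight_simplex" if "t \<ge> 0" for t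
    using adm that by (simp add: admissible_signal_def)
  have V_mono: "V (x b) \<le> V (x a)" if "0 \<le> a" "a \<le> b" for a b
    using V_antimono_along_solution[OF adm sol that] .
  obtain m where m: "m > 0" "\<And>x. m * norm x \<le> V x" using norm_le_V by blast
  define R where "R = V (x 0) / m"
  have R: "norm (x t) \<le> R" if "t \<ge> 0" for t
    using m(1) order_trans[OF m(2) V_mono[OF order_refl that]] by (simp add: R_def field_simps)
  obtain K where K: "K \<ge> 0" "\<And>w x. w \<in> weight_simplex \<Longrightarrow> norm (weighted_matrix A w *v x) \<le> K * norm x"
    using weighted_matrix_bound[of A] by blast
  define L where "L = K * R"
  have "norm (weighted_matrix A (w t) *v x t) \<le> L" if "t \<ge> 0" for t
    using K(2)[OF w[OF that], of "x t"] mult_left_mono[OF R[OF that] K(1)] by (simp add: L_def)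
  then have Lip: "norm (x b - x a) \<le> L * (b - a)" if "0 \<le> a" "a \<le> b" for a b
    using solution_Lipschitz[OF sol _ that] by blast
  have L0: "L \<ge> 0" using order_trans[OF norm_ge_zero R[OF order_refl]] K(1) by (simp add: L_def)
  \<comment> \<open>The \<open>\<omega>\<close>-limit set of the solution.\<close>
  define \<Omega> where "\<Omega> = {z. \<exists>\<tau>::nat \<Rightarrow> real. filterlim \<tau> at_top sequentially \<and> (\<lambda>k. x (\<tau> k)) \<longlonglongrightarrow> z}"
  have cluster: "\<exists>z r. strict_mono r \<and> (\<lambda>k. x (\<tau> (r k))) \<longlonglongrightarrow> z \<and> z \<in> \<Omega>"
    if \<tau>: "filterlim \<tau> at_top sequentially" "\<And>k. 0 \<le> \<tau> k" for \<tau> :: "nat \<Rightarrow> real"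
  proof -
    have sc: "seq_compact (cball (0::real ^ 'n) R)" by (simp add: compact_imp_seq_compact)
    have "\<forall>k. x (\<tau> k) \<in> cball 0 R" using R \<tau>(2) by simp
    then obtain z r where zr: "strict_mono r" "((\<lambda>k. x (\<tau> k)) \<circ> r) \<longlonglongrightarrow> z"
      using seq_compactE[OF sc, of "\<lambda>k. x (\<tau> k)"] by metis
    have "filterlim (\<lambda>k. \<tau> (r k)) at_top sequentially"
      using filterlim_compose[OF \<tau>(1) filterlim_subseq[OF zr(1)]] .
    then show ?thesis using zr unfolding \<Omega>_def comp_def by blast
  qed
  have V_le: "V z \<le> V (x t)" if z: "z \<in> \<Omega>" and t: "t \<ge> 0" for z t
  proof -
    obtain \<tau> :: "nat \<Rightarrow> real" where \<tau>: "filterlim \<tau> at_top sequentially" "(\<lambda>k. x (\<tau> k)) \<longlonglongrightarrow> z"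
      using z by (auto simp: \<Omega>_def)
    have "\<forall>\<^sub>F k in sequentially. V (x (\<tau> k)) \<le> V (x t)"
      using \<tau>(1)[unfolded filterlim_at_top, rule_format, of t]
      by eventually_elim (use V_mono t in auto)
    then show ?thesis using tendsto_V[OF \<tau>(2)] by (intro tendsto_upperbound) auto
  qed
  have V_const: "V z = V z'" if "z \<in> \<Omega>" "z' \<in> \<Omega>" for z z'
  proof -
    have "V z \<le> V z'" if z: "z \<in> \<Omega>" "z' \<in> \<Omega>" for z z'
    proof -
      obtain \<tau> :: "nat \<Rightarrow> real" where \<tau>: "filterlim \<tau> at_top sequentially" "(\<lambda>k. x (\<tau> k)) \<longlonglongrightarrow> z'"
        using z(2) by (auto simp: \<Omega>_def)
      have "\<forall>\<^sub>F k in sequentially. V z \<le> V (x (\<tau> k))"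
        using \<tau>(1)[unfolded filterlim_at_top, rule_format, of 0]
        by eventually_elim (use V_le z in auto)
      then show ?thesis using tendsto_V[OF \<tau>(2)] by (intro tendsto_lowerbound) auto
    qed
    then show ?thesis using that by (intro antisym)
  qed
  obtain z0 where z0: "z0 \<in> \<Omega>" "z0 \<noteq> 0"
  proof -
    obtain e where e: "e > 0" "\<not> (\<forall>\<^sub>F t in at_top. dist (x t) 0 < e)"
      using not0 by (auto simp: tendsto_iff)
    then have "\<forall>k::nat. \<exists>t\<ge>real k. e \<le> norm (x t)"
      by (auto simp: eventually_at_top_linorder not_less)
    then obtain \<tau> where \<tau>: "\<And>k. \<tau> k \<ge> real k" "\<And>k. e \<le> norm (x (\<tau> k))" by metis
    have "filterlim \<tau> at_top sequentially"
      using filterlim_at_top_mono[OF filterlim_real_sequentially] \<tau>(1) by (simp add: always_eventually)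
    moreover have "\<And>k. 0 \<le> \<tau> k" using \<tau>(1) of_nat_0_le_iff order_trans by blast
    ultimately obtain z r where z: "(\<lambda>k. x (\<tau> (r k))) \<longlonglongrightarrow> z" "z \<in> \<Omega>" using cluster by blast
    have "e \<le> norm z"
      using tendsto_norm[OF z(1)] \<tau>(2) by (intro tendsto_lowerbound) (auto simp: always_eventually)
    then have "z \<noteq> 0" using e(1) by auto
    then show thesis by (rule that[OF z(2)])
  qed
  \<comment> \<open>A limit point whose active set is smallest: its neighbours in \<open>\<Omega>\<close> lie on the same open face.\<close>
  define n where "n = (\<lambda>z. card (active z))"
  obtain z where z: "z \<in> \<Omega>" and minimal: "\<And>z'. z' \<in> \<Omega> \<Longrightarrow> n z \<le> n z'"
    using ex_has_least_nat[of "\<lambda>z. z \<in> \<Omega>" z0 n] z0(1) by blast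
  have "z \<noteq> 0" using V_const[OF z z0(1)] V_pos[OF z0(2)] V_0 by auto
  let ?p = "\<Sum>i\<in>active z. f i"
  obtain \<delta> \<rho> where \<delta>\<rho>: "\<delta> > 0" "\<rho> > 0"
    and dec: "\<And>w y. \<lbrakk>w \<in> weight_simplex; norm (y - z) < \<rho>\<rbrakk> \<Longrightarrow> ?p \<bullet> (weighted_matrix A w *v y) \<le> - \<delta>"
    using uniform_active_decrease[OF ker \<open>z \<noteq> 0\<close>] by blast
  obtain \<rho>' where \<rho>': "\<rho>' > 0" "\<And>y. dist y z < \<rho>' \<Longrightarrow> active y \<subseteq> active z"
    using active_nearby[of z] by (auto simp: eventually_nhds_metric)
  \<comment> \<open>A time so short that, at speed at most \<open>L\<close>, the solution cannot leave the two neighbourhoods of \<open>z\<close>.\<close>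
  define h where "h = min \<rho> \<rho>' / (2 * (L + 1))"
  have h: "h > 0" "L * h < \<rho>'" "L * h \<le> \<rho> / 2"
  proof -
    have "h > 0" using \<delta>\<rho> \<rho>' L0 by (simp add: h_def)
    moreover have "(L + 1) * h = min \<rho> \<rho>' / 2" using L0 by (simp add: h_def field_simps)
    moreover have "L * h < (L + 1) * h" using \<open>h > 0\<close> by simp
    ultimately show "h > 0" "L * h < \<rho>'" "L * h \<le> \<rho> / 2" using \<rho>' by linarith+
  qed
  obtain \<tau> :: "nat \<Rightarrow> real" where \<tau>: "filterlim \<tau> at_top sequentially" "(\<lambda>k. x (\<tau> k)) \<longlonglongrightarrow> z"
    using z by (auto simp: \<Omega>_def)
  \<comment> \<open>Estimates along the solution require nonnegative times.\<close>
  define \<sigma> where "\<sigma> k = max 0 (\<tau> k)" for k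
  have ev: "\<forall>\<^sub>F k in sequentially. \<sigma> k = \<tau> k"
    using \<tau>(1)[unfolded filterlim_at_top, rule_format, of 0] by eventually_elim (simp add: \<sigma>_def)
  have \<sigma>: "(\<lambda>k. x (\<sigma> k)) \<longlonglongrightarrow> z" "\<And>k. 0 \<le> \<sigma> k"
    using \<tau>(2) ev by (auto simp: \<sigma>_def elim!: Lim_transform_eventually eventually_mono)
  have far: "filterlim (\<lambda>k. \<sigma> k + h) at_top sequentially"
    by (rule filterlim_at_top_mono[OF \<tau>(1)]) (use h(1) in \<open>auto simp: \<sigma>_def intro!: always_eventually\<close>)
  have "0 \<le> \<sigma> k + h" for k using \<sigma>(2)[of k] h(1) by simp
  then obtain z' r where r: "strict_mono r" "(\<lambda>k. x (\<sigma> (r k) + h)) \<longlonglongrightarrow> z'" and z': "z' \<in> \<Omega>"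
    using cluster[of "\<lambda>k. \<sigma> k + h", OF far] by blast
  have \<sigma>r: "(\<lambda>k. x (\<sigma> (r k))) \<longlonglongrightarrow> z"
    using LIMSEQ_subseq_LIMSEQ[OF \<sigma>(1) r(1)] by (simp add: comp_def)
  have "norm (z' - z) \<le> L * h"
  proof (rule tendsto_upperbound[OF tendsto_norm[OF tendsto_diff[OF r(2) \<sigma>r]]])
    show "\<forall>\<^sub>F k in sequentially. norm (x (\<sigma> (r k) + h) - x (\<sigma> (r k))) \<le> L * h"
      using Lip[of "\<sigma> (r k)" "\<sigma> (r k) + h" for k] \<sigma>(2) h(1) by (intro always_eventually) auto
  qed simp
  then have sub: "active z' \<subseteq> active z" using \<rho>'(2)[of z'] h(2) by (simp add: dist_norm)
  have "card (active z') = card (active z)"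
    using minimal[OF z'] card_mono[OF finite_active sub] by (simp add: n_def)
  then have "active z' = active z" using sub finite_active by (intro card_subset_eq)
  then have same: "?p \<bullet> z' = ?p \<bullet> z"
    using active_sum_value[of z'] active_sum_value[of z] V_const[OF z' z] by simp
  have "?p \<bullet> z' - ?p \<bullet> z \<le> - \<delta> * h"
  proof (rule tendsto_upperbound[OF tendsto_diff[OF tendsto_inner[OF tendsto_const r(2)] tendsto_inner[OF tendsto_const \<sigma>r]]])
    have "\<forall>\<^sub>F k in sequentially. dist (x (\<sigma> (r k))) z < \<rho> / 2"
      using \<sigma>r \<delta>\<rho>(2) by (intro tendstoD) auto
    then show "\<forall>\<^sub>F k in sequentially. ?p \<bullet> x (\<sigma> (r k) + h) - ?p \<bullet> x (\<sigma> (r k)) \<le> - \<delta> * h"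
    proof eventually_elim
      case (elim k)
      let ?s = "\<sigma> (r k)"
      have "?p \<bullet> x (?s + h) - ?p \<bullet> x ?s \<le> - \<delta> * (?s + h - ?s)"
      proof (rule linear_functional_increment_le[OF sol \<sigma>(2)])
        show "?s \<le> ?s + h" using h(1) by simp
        fix t assume t: "t \<in> {?s..?s + h}"
        have t0: "0 \<le> t" using t \<sigma>(2)[of "r k"] by simp
        have "norm (x t - x ?s) \<le> L * (t - ?s)" using Lip[OF \<sigma>(2)] t by simp
        also have "\<dots> \<le> L * h" using t L0 by (intro mult_left_mono) auto
        finally have "norm (x t - x ?s) \<le> \<rho> / 2" using h(3) by simp
        then have "norm (x t - z) < \<rho>"
          using elim norm_triangle_ineq[of "x t - x ?s" "x ?s - z"] by (simp add: dist_norm)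
        then show "?p \<bullet> (weighted_matrix A (w t) *v x t) \<le> - \<delta>"
          using dec w[OF t0] by blast
      qed
      then show ?case by simp
    qed
  qed simp
  moreover have "\<delta> * h > 0" using \<delta>\<rho>(1) h(1) by simp
  ultimately show False using same by simp
qed

end

section \<open>The equivalence\<close>

lemma constant_solution:
  assumes "w \<in> weight_simplex" "weighted_matrix A w *v x0 = 0"
  shows "admissible_signal (\<lambda>t. w) \<and> inclusion_solution A (\<lambda>t. w) x0 (\<lambda>t. x0)"
proof -
  have "abs_continuous_on_interval 0 T (\<lambda>t. x0)" for T
    unfolding abs_continuous_on_interval_def by (intro allI impI exI[of _ 1]) simp
  moreover have "((\<lambda>t. x0) has_vector_derivative (weighted_matrix A w *v x0)) (at t within {0..})" for t
    unfolding assms(2) by (rule has_vector_derivative_const)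
  ultimately have "inclusion_solution A (\<lambda>t. w) x0 (\<lambda>t. x0)"
    unfolding inclusion_solution_def by (intro conjI allI impI AE_I2) auto
  moreover have "admissible_signal (\<lambda>t. w)"
    unfolding admissible_signal_def using assms(1) by (intro conjI borel_measurable_const) auto
  ultimately show ?thesis by simp
qed

theorem theorem6:
  fixes A :: "'m::finite \<Rightarrow> real ^ 'n::finite ^ 'n"
    and V :: "real ^ 'n \<Rightarrow> real"
  assumes "weak_polyhedral_lyapunov A V"
  shows "weak_kernel A = {0} \<longleftrightarrow>
    (\<forall>x0 w x. admissible_signal w \<and> inclusion_solution A w x0 x
        \<longrightarrow> (x \<longlongrightarrow> 0) at_top)"
proof
  assume ker: "weak_kernel A = {0}"
  note lyap = assms[unfolded weak_polyhedral_lyapunov_def]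
  have pos: "\<And>x. x \<noteq> 0 \<Longrightarrow> 0 < V x" using lyap by simp
  have Dini: "Limsup (at_right 0)
      (\<lambda>h. ereal ((V (x + h *\<^sub>R (weighted_matrix A w *v x)) - V x) / h)) \<le> 0"
    if "w \<in> weight_simplex" for w x
    using lyap that by simp
  obtain s :: nat and f where s: "1 \<le> s"
    and V: "\<forall>x. V x = Max ((\<lambda>i. f i \<bullet> x) ` {1..s})"
    using lyap by (elim conjE exE) (rule that)
  interpret G: polyhedral_gauge "{1..s}" f
  proof
    show "\<exists>i\<in>{1..s}. 0 < f i \<bullet> x" if "x \<noteq> 0" for x
      using pos[OF that] s V[rule_format, of x] by (simp add: Max_gr_iff)
  qed (use s in auto)
  have GV: "G.V = V" by (rule ext) (simp only: G.V_def V[rule_format])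
  interpret weak_polyhedral_system "{1..s}" f A
  proof
    show "f i \<bullet> (weighted_matrix A w *v x) \<le> 0" if "w \<in> weight_simplex" "i \<in> G.active x" for w i x
      using G.Dini_active[OF _ that(2)] Dini[OF that(1)] unfolding GV by blast
  qed
  show "\<forall>x0 w x. admissible_signal w \<and> inclusion_solution A w x0 x \<longrightarrow> (x \<longlongrightarrow> 0) at_top"
    using solution_tendsto_0[OF ker] by blast
next
  assume conv: "\<forall>x0 w x. admissible_signal w \<and> inclusion_solution A w x0 x \<longrightarrow> (x \<longlongrightarrow> 0) at_top"
  have "x0 = 0" if x0: "x0 \<in> weak_kernel A" for x0
  proof -
    obtain w where "w \<in> weight_simplex" "weighted_matrix A w *v x0 = 0"
      using x0 by (auto simp: weak_kernel_def)
    then have "((\<lambda>t::real. x0) \<longlongrightarrow> 0) at_top" using conv constant_solution by blast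
    then show ?thesis by (simp add: tendsto_const_iff)
  qed
  moreover have "0 \<in> weak_kernel A"
    using weight_simplex_nonempty by (auto simp: weak_kernel_def)
  ultimately show "weak_kernel A = {0}" by blast
qed

end
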